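(* Let $G$ be a finite $p$-group. Every Laplacian eigenvalue of $\mathcal{G}(G)$ is $0$, or equals $\mathrm{o}(g)$ for some $g\in G$, or equals $|\widehat{U}(h)|+\mathrm{o}(h)$ for some $h\in G$. In particular, $\mathcal{G}(G)$ is Laplacian integral.
   Context: $p$ is a prime; a $p$-group is a group of order at least two in which every element has order a power of $p$. The power graph $\mathcal{G}(G)$ has vertex set $G$, distinct $u,v$ adjacent iff one is a positive power of the other. $\mathrm{o}(g)$ is the order of $g$, $[g]=\{h\in G:\langle h\rangle=\langle g\rangle\}$, $U(g)=\{h\in G: g\in\langle h\rangle\}$, $\widehat{U}(g)=U(g)\setminus[g]$. Laplacian eigenvalues are eigenvalues of $L=D-A$; a graph is Laplacian integral if all its Laplacian eigenvalues are integers. *)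

theory Defs
  imports
    "HOL-Algebra.Algebra"
    "HOL-Computational_Algebra.Primes"
    "Graph_Theory.Pair_Digraph"
    "Jordan_Normal_Form.Char_Poly"
begin

section \<open>Laplacian eigenvalues of a graph\<close>

text \<open>
  Matrices are indexed by natural numbers, so the rows and columns of the matrices of a finite
  graph are labelled through a list \<open>vs\<close> enumerating its vertices without repetition. In the
  symmetric digraphs representing undirected graphs, out-degree is the usual degree.
\<close>

definition adjacency_matrix :: "'a list \<Rightarrow> 'a pair_pre_digraph \<Rightarrow> complex mat" where
  "adjacency_matrix vs H =
     mat (length vs) (length vs) (\<lambda>(i, j). if (vs ! i, vs ! j) \<in> parcs H then 1 else 0)"

definition degree_matrix :: "'a list \<Rightarrow> 'a pair_pre_digraph \<Rightarrow> complex mat" where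
  "degree_matrix vs H =
     mat (length vs) (length vs)
       (\<lambda>(i, j). if i = j then of_nat (out_degree (with_proj H) (vs ! i)) else 0)"

definition laplacian_matrix :: "'a list \<Rightarrow> 'a pair_pre_digraph \<Rightarrow> complex mat" where
  "laplacian_matrix vs H = degree_matrix vs H - adjacency_matrix vs H"

text \<open>
  The choice of the enumeration is immaterial, see \<open>laplacian_eigenvalue_iff\<close> below. Eigenvalues
  are taken over the complex numbers, so that no eigenvalue is excluded by the choice of field.
  The definition is meant for finite graphs; an infinite vertex set has no enumeration.
\<close>

definition laplacian_eigenvalue :: "'a pair_pre_digraph \<Rightarrow> complex \<Rightarrow> bool" where
  "laplacian_eigenvalue H k \<longleftrightarrow>
     (\<exists>vs. distinct vs \<and> set vs = pverts H \<and> eigenvalue (laplacian_matrix vs H) k)"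

definition laplacian_integral :: "'a pair_pre_digraph \<Rightarrow> bool" where
  "laplacian_integral H \<longleftrightarrow> (\<forall>k. laplacian_eigenvalue H k \<longrightarrow> k \<in> \<int>)"

lemma laplacian_matrix_carrier:
  "laplacian_matrix vs H \<in> carrier_mat (length vs) (length vs)"
  by (rule carrier_matI)
    (simp_all add: laplacian_matrix_def adjacency_matrix_def degree_matrix_def)

lemma laplacian_matrix_mult:
  assumes vs: "distinct vs" and i: "i < length vs"
  shows "(laplacian_matrix vs H *\<^sub>v vec (length vs) (\<lambda>j. f (vs ! j))) $ i =
    of_nat (out_degree (with_proj H) (vs ! i)) * f (vs ! i)
      - (\<Sum>v | v \<in> set vs \<and> (vs ! i, v) \<in> parcs H. f v)"
proof -
  let ?n = "length vs"
  have "(laplacian_matrix vs H *\<^sub>v vec ?n (\<lambda>j. f (vs ! j))) $ i =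
    (\<Sum>j = 0..<?n. ((if i = j then of_nat (out_degree (with_proj H) (vs ! i)) else 0)
       - (if (vs ! i, vs ! j) \<in> parcs H then 1 else 0)) * f (vs ! j))"
    using i by (simp add: laplacian_matrix_def adjacency_matrix_def degree_matrix_def
        scalar_prod_def)
  also have "\<dots> = (\<Sum>j = 0..<?n. (if i = j then
        of_nat (out_degree (with_proj H) (vs ! i)) * f (vs ! j) else 0))
      - (\<Sum>j = 0..<?n. if (vs ! i, vs ! j) \<in> parcs H then f (vs ! j) else 0)"
    by (subst sum_subtractf[symmetric], rule sum.cong) (auto simp: algebra_simps)
  also have "(\<Sum>j = 0..<?n. (if i = j then
        of_nat (out_degree (with_proj H) (vs ! i)) * f (vs ! j) else 0))
      = of_nat (out_degree (with_proj H) (vs ! i)) * f (vs ! i)"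
    using i by simp
  also have "(\<Sum>j = 0..<?n. if (vs ! i, vs ! j) \<in> parcs H then f (vs ! j) else 0)
      = (\<Sum>v\<in>set vs. if (vs ! i, v) \<in> parcs H then f v else 0)"
    by (rule sum.reindex_bij_betw[OF bij_betw_nth[OF vs]]) auto
  also have "\<dots> = (\<Sum>v | v \<in> set vs \<and> (vs ! i, v) \<in> parcs H. f v)"
    by (simp add: sum.inter_filter)
  finally show ?thesis .
qed

lemma eigenvalue_laplacian_matrix_iff:
  assumes vs: "distinct vs" "set vs = pverts H"
  shows "eigenvalue (laplacian_matrix vs H) k \<longleftrightarrow>
    (\<exists>f. (\<exists>u\<in>pverts H. f u \<noteq> 0) \<and>
      (\<forall>u\<in>pverts H. of_nat (out_degree (with_proj H) u) * f u
        - (\<Sum>v | v \<in> pverts H \<and> (u, v) \<in> parcs H. f v) = k * f u))"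
    (is "_ \<longleftrightarrow> (\<exists>f. ?P f)")
proof
  let ?n = "length vs"
  assume "eigenvalue (laplacian_matrix vs H) k"
  then obtain x where x: "x \<in> carrier_vec ?n" "x \<noteq> 0\<^sub>v ?n"
    and ev: "laplacian_matrix vs H *\<^sub>v x = k \<cdot>\<^sub>v x"
    using laplacian_matrix_carrier[of vs H] unfolding eigenvalue_def eigenvector_def by auto
  define f where "f v = x $ (the_inv_into {..<?n} ((!) vs) v)" for v
  have f: "f (vs ! i) = x $ i" if "i < ?n" for i
    using that bij_betw_nth[OF vs(1) refl refl]
    by (simp add: f_def the_inv_into_f_f bij_betw_def)
  have xf: "x = vec ?n (\<lambda>j. f (vs ! j))"
    by (rule eq_vecI) (use x(1) f in simp_all)
  obtain i where i: "i < ?n" "x $ i \<noteq> 0"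
    using x by (auto simp: vec_eq_iff)
  have "?P f"
  proof (intro conjI ballI)
    show "\<exists>u\<in>pverts H. f u \<noteq> 0"
      by (rule bexI[of _ "vs ! i"]) (use i f[OF i(1)] nth_mem[OF i(1)] vs(2) in simp_all)
  next
    fix u assume "u \<in> pverts H"
    then obtain j where j: "j < ?n" "u = vs ! j"
      using vs(2) by (metis in_set_conv_nth)
    have "(laplacian_matrix vs H *\<^sub>v x) $ j = k * f u"
      unfolding ev j(2) f[OF j(1)] using j(1) x(1) by simp
    then show "of_nat (out_degree (with_proj H) u) * f u
        - (\<Sum>v | v \<in> pverts H \<and> (u, v) \<in> parcs H. f v) = k * f u"
      using laplacian_matrix_mult[OF vs(1) j(1), of H f]
      unfolding xf[symmetric] j(2)[symmetric] vs(2) by simp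
  qed
  then show "\<exists>f. ?P f" by blast
next
  let ?n = "length vs"
  assume "\<exists>f. ?P f"
  then obtain f where f: "?P f" by blast
  let ?x = "vec ?n (\<lambda>j. f (vs ! j))"
  obtain u where "u \<in> set vs" "f u \<noteq> 0"
    using f vs(2) by blast
  then obtain i where i: "i < ?n" "f (vs ! i) \<noteq> 0"
    by (auto simp: in_set_conv_nth)
  have "?x \<noteq> 0\<^sub>v ?n"
    using i by (auto simp: vec_eq_iff)
  moreover have "laplacian_matrix vs H *\<^sub>v ?x = k \<cdot>\<^sub>v ?x"
  proof (rule eq_vecI)
    fix j assume "j < dim_vec (k \<cdot>\<^sub>v ?x)"
    then have j: "j < ?n" by simp
    then have u: "vs ! j \<in> pverts H" using vs(2) nth_mem by blast
    have "(laplacian_matrix vs H *\<^sub>v ?x) $ j = k * f (vs ! j)"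
      unfolding laplacian_matrix_mult[OF vs(1) j] vs(2) using f u by blast
    then show "(laplacian_matrix vs H *\<^sub>v ?x) $ j = (k \<cdot>\<^sub>v ?x) $ j"
      using j by simp
  qed (use laplacian_matrix_carrier[of vs H] in auto)
  ultimately show "eigenvalue (laplacian_matrix vs H) k"
    using laplacian_matrix_carrier[of vs H] unfolding eigenvalue_def eigenvector_def
    by (intro exI[of _ ?x]) simp
qed

lemma laplacian_eigenvalue_iff:
  assumes "distinct vs" "set vs = pverts H"
  shows "laplacian_eigenvalue H k \<longleftrightarrow> eigenvalue (laplacian_matrix vs H) k"
proof
  assume "laplacian_eigenvalue H k"
  then obtain ws where ws: "distinct ws" "set ws = pverts H"
    and "eigenvalue (laplacian_matrix ws H) k"
    by (auto simp: laplacian_eigenvalue_def)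
  then show "eigenvalue (laplacian_matrix vs H) k"
    by (simp only: eigenvalue_laplacian_matrix_iff[OF ws] eigenvalue_laplacian_matrix_iff[OF assms])
qed (use assms in \<open>auto simp: laplacian_eigenvalue_def\<close>)


section \<open>Power graphs and \<open>p\<close>-groups\<close>

text \<open>Undirected edges are represented by pairs of opposite arcs.\<close>

definition power_graph :: "('a, 'b) monoid_scheme \<Rightarrow> 'a pair_pre_digraph" where
  "power_graph G =
     \<lparr> pverts = carrier G,
       parcs = {(u, v). u \<in> carrier G \<and> v \<in> carrier G \<and> u \<noteq> v \<and>
         (\<exists>n::nat. n > 0 \<and> (u = v [^]\<^bsub>G\<^esub> n \<or> v = u [^]\<^bsub>G\<^esub> n))} \<rparr>"

lemma pair_graph_power_graph:
  assumes "finite (carrier G)"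
  shows "pair_graph (power_graph G)"
proof
  show "finite (parcs (power_graph G))"
    by (rule finite_subset[of _ "carrier G \<times> carrier G"])
      (use assms in \<open>auto simp: power_graph_def\<close>)
  show "finite (pverts (power_graph G))" using assms by (simp add: power_graph_def)
  show "symmetric (with_proj (power_graph G))"
    by (auto simp: symmetric_def power_graph_def intro: symI)
qed (auto simp: power_graph_def)

text \<open>
  Elements of infinite order have \<open>ord\<close> equal to 0, which is not a power of \<open>p\<close>. The trivial
  group is not a \<open>p\<close>-group.
\<close>

definition p_group :: "nat \<Rightarrow> ('a, 'b) monoid_scheme \<Rightarrow> bool" where
  "p_group p G \<longleftrightarrow> Factorial_Ring.prime p \<and> group G \<and> carrier G \<noteq> {\<one>\<^bsub>G\<^esub>} \<and>
     (\<forall>g\<in>carrier G. \<exists>k::nat. group.ord G g = p ^ k)"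

definition gen_class :: "('a, 'b) monoid_scheme \<Rightarrow> 'a \<Rightarrow> 'a set" where
  "gen_class G g = {h \<in> carrier G. generate G {h} = generate G {g}}"

definition up_set :: "('a, 'b) monoid_scheme \<Rightarrow> 'a \<Rightarrow> 'a set" where
  "up_set G g = {h \<in> carrier G. g \<in> generate G {h}}"

definition strict_up_set :: "('a, 'b) monoid_scheme \<Rightarrow> 'a \<Rightarrow> 'a set" where
  "strict_up_set G g = up_set G g - gen_class G g"

end

theory Submission
  imports Defs "HOL-Number_Theory.Cong"
begin

text \<open>
  In a finite \<open>p\<close>-group, \<open>u \<in> \<langle>v\<rangle>\<close> is a preorder in which the elements below a given one form a
  chain, and the power graph is its comparability graph. Let \<open>f\<close> be an eigenvector for \<open>k\<close>, and
  choose \<open>u\<close> with \<open>f u \<noteq> 0\<close> and \<open>f\<close> vanishing on the set \<open>B\<close> of elements strictly below \<open>u\<close>.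
  By the chain condition the only edges leaving the up-set \<open>U\<close> of \<open>u\<close> lead to \<open>B\<close>, and
  every element of \<open>U\<close> is joined to all of \<open>B\<close>. Adding up the eigenvector equations over
  \<open>U\<close>, the edges inside \<open>U\<close> cancel, which leaves \<open>|B| * T = k * T\<close> with \<open>T\<close> the sum of \<open>f\<close>
  over \<open>U\<close>. So \<open>k = |B|\<close>, where \<open>B\<close> is empty or the cyclic group generated by its largest
  element; or \<open>T = 0\<close>, and then the equation at \<open>u\<close> gives \<open>k = |U| + |B|\<close>.
\<close>

lemma laplacian_eigenvalue_comparability_graph:
  fixes f :: "'a \<Rightarrow> 'c::field_char_0" and le :: "'a \<Rightarrow> 'a \<Rightarrow> bool"
  assumes fin: "finite V"
    and le_refl: "\<And>x. x \<in> V \<Longrightarrow> le x x"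
    and le_trans: "\<And>x y z. x \<in> V \<Longrightarrow> y \<in> V \<Longrightarrow> z \<in> V \<Longrightarrow> le x y \<Longrightarrow> le y z \<Longrightarrow> le x z"
    and chain: "\<And>x y z. x \<in> V \<Longrightarrow> y \<in> V \<Longrightarrow> z \<in> V \<Longrightarrow> le x z \<Longrightarrow> le y z \<Longrightarrow> le x y \<or> le y x"
    and ev: "\<And>u. u \<in> V \<Longrightarrow> (\<Sum>v | v \<in> V \<and> (le u v \<or> le v u). f u - f v) = k * f u"
    and nonzero: "\<exists>u\<in>V. f u \<noteq> 0"
  obtains u where "u \<in> V"
    and "k = of_nat (card {v \<in> V. le v u \<and> \<not> le u v}) \<or>
         k = of_nat (card {v \<in> V. le u v} + card {v \<in> V. le v u \<and> \<not> le u v})"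
proof -
  let ?B = "\<lambda>u. {v \<in> V. le v u \<and> \<not> le u v}"
  let ?D = "\<lambda>u. {v \<in> V. le v u}"
  \<comment> \<open>Minimising the size of the down-set over the support of \<open>f\<close> forces
    \<open>f\<close> to vanish strictly below \<open>u\<close>, since elements there have strictly
    smaller down-sets.\<close>
  obtain u where u: "u \<in> V" "f u \<noteq> 0"
    and least: "\<And>v. v \<in> V \<Longrightarrow> f v \<noteq> 0 \<Longrightarrow> card (?D u) \<le> card (?D v)"
    using arg_min_nat_lemma[of "\<lambda>u. u \<in> V \<and> f u \<noteq> 0" _ "\<lambda>u. card (?D u)"] nonzero by blast
  define U where "U = {v \<in> V. le u v}"
  have finU: "finite U" and finB: "finite (?B u)" using fin by (auto simp: U_def)
  have zero: "f v = 0" if "v \<in> ?B u" for v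
  proof (rule ccontr)
    assume "f v \<noteq> 0"
    moreover have "card (?D v) < card (?D u)"
    proof (rule psubset_card_mono)
      show "?D v \<subset> ?D u" using that u(1) le_refl le_trans by blast
    qed (use fin in simp)
    ultimately show False using least[of v] that by simp
  qed
  \<comment> \<open>Anything above \<open>v\<close> lies above \<open>u\<close>. If \<open>w\<close>
    is below \<open>v\<close>, then \<open>w\<close> and \<open>u\<close> have the common upper
    bound \<open>v\<close>, so \<open>chain\<close> puts \<open>w\<close> in \<open>U\<close> or
    strictly below \<open>u\<close>.\<close>
  have nbhd: "{w. w \<in> V \<and> (le v w \<or> le w v)} = {w \<in> U. le v w \<or> le w v} \<union> ?B u" if "v \<in> U" for v
    using that u(1) le_trans chain unfolding U_def by blast
  have disj: "{w \<in> U. P w} \<inter> ?B u = {}" for P by (auto simp: U_def)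
  have eq: "(\<Sum>w | w \<in> U \<and> (le v w \<or> le w v). f v - f w) + of_nat (card (?B u)) * f v = k * f v"
    if "v \<in> U" for v
  proof -
    have "k * f v = (\<Sum>w | w \<in> V \<and> (le v w \<or> le w v). f v - f w)"
      using ev[of v] that by (simp add: U_def)
    also have "\<dots> = (\<Sum>w | w \<in> U \<and> (le v w \<or> le w v). f v - f w) + (\<Sum>w\<in>?B u. f v - f w)"
      unfolding nbhd[OF that] by (rule sum.union_disjoint) (use finU finB disj in auto)
    also have "(\<Sum>w\<in>?B u. f v - f w) = (\<Sum>w\<in>?B u. f v)"
      by (rule sum.cong) (use zero in auto)
    finally show ?thesis by simp
  qed
  define S where "S = (\<Sum>v\<in>U. \<Sum>w | w \<in> U \<and> (le v w \<or> le w v). f v - f w)"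
  define T where "T = (\<Sum>v\<in>U. f v)"
  \<comment> \<open>Comparability is symmetric and \<open>f v - f w\<close> antisymmetric, so
    exchanging the two summations turns \<open>S\<close> into \<open>- S\<close>.\<close>
  have S: "S = (\<Sum>v\<in>U. \<Sum>w\<in>U. if le v w \<or> le w v then f v - f w else 0)"
    unfolding S_def by (simp only: sum.inter_filter[OF finU])
  also have "\<dots> = (\<Sum>v\<in>U. \<Sum>w\<in>U. if le v w \<or> le w v then f w - f v else 0)"
    by (subst sum.swap) (intro sum.cong; auto)
  also have "\<dots> = - S"
    unfolding S sum_negf[symmetric] by (intro sum.cong) auto
  finally have "S + S = 0" by (simp only: eq_neg_iff_add_eq_0)
  then have "S = 0" by (simp flip: mult_2)
  then have "of_nat (card (?B u)) * T = k * T"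
    using sum.cong[OF refl eq, of U "\<lambda>v. v"]
    by (simp add: sum.distrib S_def T_def sum_distrib_left)
  then consider "k = of_nat (card (?B u))" | "T = 0" by auto
  then show ?thesis
  proof cases
    case 1
    then show ?thesis using that u(1) by blast
  next
    case 2
    have uU: "u \<in> U" using u(1) le_refl by (simp add: U_def)
    \<comment> \<open>Within \<open>U\<close> every element is comparable to \<open>u\<close>, so
      the inner sum at \<open>u\<close> is \<open>card U * f u - T\<close>.\<close>
    have "{w. w \<in> U \<and> (le u w \<or> le w u)} = U" by (auto simp: U_def)
    then have "(of_nat (card U) + of_nat (card (?B u))) * f u = k * f u"
      using eq[OF uU] 2 by (simp add: sum_subtractf T_def algebra_simps)
    then have "k = of_nat (card U + card (?B u))" using u(2) by simp
    then show ?thesis using that u(1) unfolding U_def by blast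
  qed
qed

context group
begin

text \<open>Exponents of \<open>v\<close> matter only modulo \<open>ord v\<close>, and by Bezout
  some multiple of \<open>b\<close> is congruent to \<open>gcd b (ord v)\<close>.\<close>

lemma pow_in_generate_pow:
  assumes "finite (carrier G)" and v: "v \<in> carrier G" and dvd: "gcd b (ord v) dvd a"
  shows "v [^] (a::nat) \<in> generate G {v [^] (b::nat)}"
proof -
  obtain c where c: "a = gcd b (ord v) * c" using dvd by auto
  have red: "v [^] (m mod ord v) = v [^] m" for m :: nat
  proof -
    have "v [^] m = v [^] (ord v * (m div ord v) + m mod ord v)" by simp
    also have "\<dots> = (v [^] ord v) [^] (m div ord v) \<otimes> v [^] (m mod ord v)"
      using v by (simp only: nat_pow_mult nat_pow_pow nat_pow_closed)
    finally show ?thesis using v by simp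
  qed
  obtain x where "b * x mod ord v = gcd b (ord v) mod ord v"
    using cong_solve_nat[of b "ord v"] unfolding cong_def by blast
  then have "b * x * c mod ord v = a mod ord v"
    unfolding c by (metis mod_mult_left_eq)
  then have "v [^] a = v [^] (b * (x * c))"
    using red[of a] red[of "b * (x * c)"] by (simp add: mult.assoc)
  also have "\<dots> = (v [^] b) [^] (x * c)" using v by (simp add: nat_pow_pow)
  finally show ?thesis using generate_pow_on_finite_carrier[OF assms(1), of "v [^] b"] v by auto
qed

lemma generate_singleton_trans:
  assumes "z \<in> carrier G" "x \<in> generate G {y}" "y \<in> generate G {z}"
  shows "x \<in> generate G {z}"
  using generate_subgroup_incl[of "{y}" "generate G {z}"] generate_is_subgroup[of "{z}"] assms
  by blast

lemma generate_singleton_eq_iff: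
  assumes "x \<in> carrier G" "y \<in> carrier G"
  shows "generate G {x} = generate G {y} \<longleftrightarrow> x \<in> generate G {y} \<and> y \<in> generate G {x}"
  using assms generate_singleton_trans generate.incl[of _ "{_}" G] by blast

text \<open>Adding \<open>ord x\<close> to an exponent makes it positive without changing the power.
  This matches the positive powers in \<open>power_graph\<close> with membership in cyclic
  subgroups.\<close>

lemma generate_singleton_eq_pos_pow:
  assumes fin: "finite (carrier G)" and x: "x \<in> carrier G"
  shows "generate G {x} = {x [^] n | n::nat. n > 0}"
proof -
  have "\<exists>m::nat. m > 0 \<and> x [^] n = x [^] m" for n :: nat
    using ord_ge_1[OF fin x] x
    by (intro exI[of _ "n + ord x"]) (simp add: nat_pow_mult[symmetric])
  then show ?thesis unfolding generate_pow_on_finite_carrier[OF assms] by blast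
qed

text \<open>The divisors of a prime power are totally ordered by divisibility, so the gcds of the
  two exponents with \<open>ord v\<close> are comparable.\<close>

lemma prime_power_order_generate_chain:
  assumes fin: "finite (carrier G)" and p: "Factorial_Ring.prime p" and v: "v \<in> carrier G"
    and ord: "ord v = p ^ n" and xy: "x \<in> generate G {v}" "y \<in> generate G {v}"
  shows "x \<in> generate G {y} \<or> y \<in> generate G {x}"
proof -
  obtain a b :: nat where ab: "x = v [^] a" "y = v [^] b"
    using xy generate_pow_on_finite_carrier[OF fin v] by auto
  obtain i j where "gcd a (ord v) = p ^ i" "gcd b (ord v) = p ^ j"
    using divides_primepow_nat[OF p] ord by (metis gcd_dvd2)
  then have "gcd a (ord v) dvd gcd b (ord v) \<or> gcd b (ord v) dvd gcd a (ord v)"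
    by (metis le_imp_power_dvd nat_le_linear)
  then have "gcd a (ord v) dvd b \<or> gcd b (ord v) dvd a"
    by (meson dvd_trans gcd_dvd1)
  then show ?thesis
    unfolding ab using pow_in_generate_pow[OF fin v] by blast
qed

end

lemma power_graph_arc_iff:
  assumes "group G" "finite (carrier G)"
  shows "(u, v) \<in> parcs (power_graph G) \<longleftrightarrow> u \<in> carrier G \<and> v \<in> carrier G \<and> u \<noteq> v \<and>
    (u \<in> generate G {v} \<or> v \<in> generate G {u})"
proof -
  interpret group G by fact
  show ?thesis
    unfolding power_graph_def using generate_singleton_eq_pos_pow[OF assms(2)] by auto
qed

lemma out_degree_with_proj:
  "out_degree (with_proj H) u = card {v. (u, v) \<in> parcs H}"
proof -
  have "out_arcs (with_proj H) u = Pair u ` {v. (u, v) \<in> parcs H}"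
    by (auto simp: out_arcs_def)
  then show ?thesis by (simp add: out_degree_def card_image inj_on_def)
qed

text \<open>An element \<open>g\<close> of largest order in \<open>B\<close> generates
  \<open>B\<close>: any \<open>x\<close> in \<open>B\<close> outside the group generated by
  \<open>g\<close> would, by \<open>chain\<close>, generate a strictly larger group. Conversely,
  \<open>B\<close> is closed under passing to generated elements.\<close>

lemma card_strictly_below:
  assumes "group G" and fin: "finite (carrier G)" and h: "h \<in> carrier G"
    and chain: "\<And>x y. x \<in> generate G {h} \<Longrightarrow> y \<in> generate G {h} \<Longrightarrow>
      x \<in> generate G {y} \<or> y \<in> generate G {x}"
  defines "B \<equiv> {x \<in> carrier G. x \<in> generate G {h} \<and> h \<notin> generate G {x}}"
  shows "B = {} \<or> (\<exists>g\<in>carrier G. card B = group.ord G g)"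
proof (cases "B = {}")
  case False
  interpret group G by fact
  have finB: "finite B" using fin by (simp add: B_def)
  obtain g where g: "g \<in> B" and greatest: "\<And>x. x \<in> B \<Longrightarrow> ord x \<le> ord g"
    using finB False by (metis obtains_MAX Max_ge finite_imageI image_eqI)
  have gc: "g \<in> carrier G" using g by (simp add: B_def)
  have "x \<in> generate G {g}" if x: "x \<in> B" for x
  proof (rule ccontr)
    assume nx: "x \<notin> generate G {g}"
    have xc: "x \<in> carrier G" using x by (simp add: B_def)
    have "g \<in> generate G {x}" using chain g x nx by (auto simp: B_def)
    then have "generate G {g} \<subset> generate G {x}"
      using nx generate_singleton_trans[OF xc] generate.incl[of x "{x}" G] by blast
    moreover have "finite (generate G {x})"
      using fin generate_incl[of "{x}"] xc finite_subset by blast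
    ultimately have "ord g < ord x"
      unfolding generate_pow_card[OF gc] generate_pow_card[OF xc] by (rule psubset_card_mono[rotated])
    then show False using greatest[OF x] by simp
  qed
  moreover have "x \<in> B" if x: "x \<in> generate G {g}" for x
    using x g h gc generate_singleton_trans[of h x g] generate_singleton_trans[of g h x]
      generate_incl[of "{g}"]
    by (auto simp: B_def)
  ultimately have "B = generate G {g}" by blast
  then have "card B = ord g" using generate_pow_card[OF gc] by simp
  then show ?thesis using gc by blast
qed simp

theorem theorem3p22:
  fixes G :: "('a, 'b) monoid_scheme" and p :: nat
  assumes "p_group p G" and "finite (carrier G)"
  shows "(\<forall>k :: complex. laplacian_eigenvalue (power_graph G) k \<longrightarrow>
            k = 0 \<or>
            (\<exists>g\<in>carrier G. k = of_nat (group.ord G g)) \<or>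
            (\<exists>h\<in>carrier G. k = of_nat (card (strict_up_set G h) + group.ord G h)))
         \<and> laplacian_integral (power_graph G)"
proof -
  have grp: "group G" and p: "Factorial_Ring.prime p"
    and pow: "\<And>g. g \<in> carrier G \<Longrightarrow> \<exists>n. group.ord G g = p ^ n"
    using assms(1) by (auto simp: p_group_def)
  interpret group G by fact
  note fin = assms(2)
  define le where "le x y \<longleftrightarrow> x \<in> generate G {y}" for x y
  define B where "B h = {x \<in> carrier G. le x h \<and> \<not> le h x}" for h
  have le_refl: "le x x" for x by (simp add: le_def generate.incl)
  have chain: "le x y \<or> le y x" if "z \<in> carrier G" "le x z" "le y z" for x y z
    using prime_power_order_generate_chain[OF fin p] pow that unfolding le_def by blast
  \<comment> \<open>The cyclic group of \<open>h\<close> splits into its generators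
    \<open>gen_class G h\<close> and \<open>B h\<close>; moving the generators out of the up-set
    turns |U| + |B| into the form required by the theorem.\<close>
  have cardU: "card (up_set G h) + card (B h) = card (strict_up_set G h) + ord h"
    if h: "h \<in> carrier G" for h
  proof -
    have fins: "finite (up_set G h)" "finite (B h)" "finite (gen_class G h)"
      using fin by (auto simp: up_set_def B_def gen_class_def)
    have sub: "gen_class G h \<subseteq> up_set G h"
      by (auto simp: gen_class_def up_set_def generate.incl)
    have "gen_class G h \<union> B h = generate G {h}"
      using generate_incl[of "{h}"] h generate_singleton_eq_iff[OF _ h]
      unfolding gen_class_def B_def le_def by blast
    moreover have "gen_class G h \<inter> B h = {}"
      using generate_singleton_eq_iff[OF _ h] unfolding gen_class_def B_def le_def by blast
    ultimately have "ord h = card (gen_class G h) + card (B h)"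
      using fins generate_pow_card[OF h] by (metis card_Un_disjoint)
    then show ?thesis
      using card_Diff_subset[OF fins(3) sub] card_mono[OF fins(1) sub]
      by (simp add: strict_up_set_def)
  qed
  have main: "k = 0 \<or> (\<exists>g\<in>carrier G. k = of_nat (ord g)) \<or>
      (\<exists>h\<in>carrier G. k = of_nat (card (strict_up_set G h) + ord h))"
    if k: "laplacian_eigenvalue (power_graph G) k" for k :: complex
  proof -
    have V: "pverts (power_graph G) = carrier G" by (simp add: power_graph_def)
    obtain f where nonzero: "\<exists>u\<in>carrier G. f u \<noteq> 0"
      and ev: "\<And>u. u \<in> carrier G \<Longrightarrow> of_nat (out_degree (with_proj (power_graph G)) u) * f u
        - (\<Sum>v | v \<in> carrier G \<and> (u, v) \<in> parcs (power_graph G). f v) = k * f u"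
      using k eigenvalue_laplacian_matrix_iff[of _ "power_graph G" k]
      unfolding laplacian_eigenvalue_def V by blast
    \<comment> \<open>Reflexivity of \<open>le\<close> adds \<open>v = u\<close> to the neighbours,
      but that term is \<open>f u - f u = 0\<close>.\<close>
    have eq: "(\<Sum>v | v \<in> carrier G \<and> (le u v \<or> le v u). f u - f v) = k * f u"
      if u: "u \<in> carrier G" for u
    proof -
      let ?N = "{v. (u, v) \<in> parcs (power_graph G)}"
      have N: "{v. v \<in> carrier G \<and> (le u v \<or> le v u)} = insert u ?N"
        "{v. v \<in> carrier G \<and> (u, v) \<in> parcs (power_graph G)} = ?N" "u \<notin> ?N"
        using u le_refl by (auto simp: power_graph_arc_iff[OF grp fin] le_def)
      have "finite ?N" using N(2) fin by (metis (no_types, lifting) finite_subset mem_Collect_eq subsetI)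
      then show ?thesis
        using ev[OF u] N(3) unfolding N(1,2)
        by (simp add: out_degree_with_proj sum_subtractf algebra_simps)
    qed
    obtain h where h: "h \<in> carrier G"
      and kh: "k = of_nat (card (B h)) \<or> k = of_nat (card (up_set G h) + card (B h))"
    proof (rule laplacian_eigenvalue_comparability_graph[OF fin _ _ _ eq nonzero])
      show "le x z" if "z \<in> carrier G" "le x y" "le y z" for x y z
        using that generate_singleton_trans unfolding le_def by blast
    qed (use le_refl chain in \<open>auto simp: B_def up_set_def le_def[symmetric]\<close>)
    have "B h = {} \<or> (\<exists>g\<in>carrier G. card (B h) = ord g)"
      using card_strictly_below[OF grp fin h] chain[OF h] unfolding B_def le_def by blast
    then show ?thesis using kh cardU[OF h] h by (metis card.empty of_nat_0)
  qed
  then have "laplacian_integral (power_graph G)"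
    unfolding laplacian_integral_def by (metis Ints_0 Ints_of_nat)
  with main show ?thesis by blast
qed

end
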